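(* Let $k\in\{1,\dots,K\}$, and let $f_{\mathrm{SINR}_k}:\mathbb{C}^{N\tau}\to\mathbb{R}$ be the radar SINR function $$f_{\mathrm{SINR}_k}(\mathbf{x})=\sigma_k^2\,\mathbf{x}^{\mathrm H}\mathbf{B}_k^{\mathrm H}\mathbf{C}_k^{-1}\mathbf{B}_k\mathbf{x},\qquad \mathbf{C}_k=\mathbf{C}_k(\mathbf{x})=\sum_{i\in\mathcal{L},\,i\ne \ell_k}\sigma_i^2\mathbf{B}_i\mathbf{x}\mathbf{x}^{\mathrm H}\mathbf{B}_i^{\mathrm H}+\sigma_{\mathrm r}^2\mathbf{I}.$$ For $\varphi_1,\dots,\varphi_\tau\in\mathbb{R}$ let $\boldsymbol{\Omega}=\mathrm{diag}(e^{\mathrm{j}\varphi_1},\dots,e^{\mathrm{j}\varphi_\tau})$. Then for every $\mathbf{x}\in\mathbb{C}^{N\tau}$ and all $\varphi_1,\dots,\varphi_\tau\in\mathbb{R}$, the vector $\tilde{\mathbf{x}}=(\boldsymbol{\Omega}\otimes\mathbf{I}_N)\mathbf{x}$ satisfies $$f_{\mathrm{SINR}_k}(\tilde{\mathbf{x}})=f_{\mathrm{SINR}_k}(\mathbf{x}).$$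
   Context: $N,\tau,K,L\ge1$ are integers and $\mathcal{L}=\{1,\dots,L\}$ indexes a finite set of angles (targets and clutter). For each $i\in\mathcal{L}$ there are a steering vector $\mathbf{a}_i\in\mathbb{C}^N$, a variance $\sigma_i^2\ge 0$, and the matrix $\mathbf{B}_i=\mathbf{I}_\tau\otimes(\mathbf{a}_i\mathbf{a}_i^{\mathrm H})\in\mathbb{C}^{N\tau\times N\tau}$. Target $k$ is located at the angle with index $\ell_k\in\mathcal{L}$; the symbols $\mathbf{B}_k$ and $\sigma_k^2$ for target $k$ mean the quantities $\mathbf{B}_{\ell_k}$ and $\sigma_{\ell_k}^2$ attached to that angle. The noise variance satisfies $\sigma_{\mathrm r}^2>0$. Here $\otimes$ is the Kronecker product, $(\cdot)^{\mathrm H}$ the conjugate transpose, $\mathrm{j}$ the imaginary unit, and $\mathbf{x}=\mathrm{vec}(\mathbf{X})$ is the column-stacking of the transmit matrix $\mathbf{X}=[\mathbf{x}_1,\dots,\mathbf{x}_\tau]\in\mathbb{C}^{N\times\tau}$, so that $\tilde{\mathbf{x}}$ stacks the vectors $e^{\mathrm{j}\varphi_t}\mathbf{x}_t$. *)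

theory Defs
  imports "HOL-Analysis.Analysis"
begin

text \<open>
  Vectors in \<open>N\<tau>\<close>-dimensional space are indexed by pairs \<open>(t, n)\<close>, the first component being
  the time slot and the second the antenna. The component \<open>(t, n)\<close> of \<open>x = vec X\<close> is the
  entry of \<open>X\<close> in row \<open>n\<close> and column \<open>t\<close>, which column-stacking puts at position
  \<open>(t - 1) N + n\<close>. This agrees with the block ordering of the Kronecker product below.
\<close>

definition kron :: "complex^'b^'a \<Rightarrow> complex^'d^'c \<Rightarrow> complex^('b \<times> 'd)^('a \<times> 'c)"
    (infixl \<open>\<otimes>\<^sub>K\<close> 70)
  where "A \<otimes>\<^sub>K B = (\<chi> r s. A $ fst r $ fst s * B $ snd r $ snd s)"

definition ctranspose :: "complex^'b^'a \<Rightarrow> complex^'a^'b"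
  where "ctranspose A = (\<chi> i j. cnj (A $ j $ i))"

text \<open>The matrix \<open>u v\<^sup>H\<close> and the scalar \<open>u\<^sup>H v\<close> for column vectors \<open>u\<close>, \<open>v\<close>.\<close>

definition outer :: "complex^'a \<Rightarrow> complex^'b \<Rightarrow> complex^'b^'a"
  where "outer u v = (\<chi> i j. u $ i * cnj (v $ j))"

definition cdot :: "complex^'a \<Rightarrow> complex^'a \<Rightarrow> complex"
  where "cdot u v = (\<Sum>i\<in>UNIV. cnj (u $ i) * v $ i)"

definition diag_matrix :: "('a \<Rightarrow> complex) \<Rightarrow> complex^'a^'a"
  where "diag_matrix d = (\<chi> i j. if i = j then d i else 0)"

definition angle_matrix :: "complex^'n \<Rightarrow> complex^('t::finite \<times> 'n)^('t \<times> 'n)"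
  where "angle_matrix a = mat 1 \<otimes>\<^sub>K outer a a"

text \<open>
  In the definitions below, \<open>v i\<close> and \<open>vr\<close> are the variances (already squared)
  \<open>\<sigma>\<^sub>i\<^sup>2\<close> and \<open>\<sigma>\<^sub>r\<^sup>2\<close>, and \<open>l\<close> is the angle index of the target.
\<close>

definition interference ::
    "nat \<Rightarrow> (nat \<Rightarrow> complex^'n) \<Rightarrow> (nat \<Rightarrow> real) \<Rightarrow> real \<Rightarrow> nat
      \<Rightarrow> complex^('t::finite \<times> 'n) \<Rightarrow> complex^('t \<times> 'n)^('t \<times> 'n)"
  where "interference L a v vr l x =
    (\<Sum>i\<in>{1..L} - {l}. v i *\<^sub>R (angle_matrix (a i) ** outer x x ** ctranspose (angle_matrix (a i))))
      + vr *\<^sub>R mat 1"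

definition sinr_form ::
    "nat \<Rightarrow> (nat \<Rightarrow> complex^'n) \<Rightarrow> (nat \<Rightarrow> real) \<Rightarrow> real \<Rightarrow> nat
      \<Rightarrow> complex^('t::finite \<times> 'n) \<Rightarrow> complex"
  where "sinr_form L a v vr l x =
    complex_of_real (v l) *
      cdot x ((ctranspose (angle_matrix (a l)) ** matrix_inv (interference L a v vr l x)
                ** angle_matrix (a l)) *v x)"

text \<open>
  The SINR is real-valued; taking the real part loses nothing by \<open>of_real_sinr\<close> below.
\<close>

definition sinr ::
    "nat \<Rightarrow> (nat \<Rightarrow> complex^'n) \<Rightarrow> (nat \<Rightarrow> real) \<Rightarrow> real \<Rightarrow> nat \<Rightarrow> complex^('t::finite \<times> 'n) \<Rightarrow> real"
  where "sinr L a v vr l x = Re (sinr_form L a v vr l x)"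

lemma cdot_mult_right: "cdot u (A *v w) = cdot (ctranspose A *v u) w"
proof -
  have "cdot u (A *v w) = (\<Sum>i\<in>UNIV. \<Sum>j\<in>UNIV. cnj (u $ i) * (A $ i $ j * w $ j))"
    by (simp add: cdot_def matrix_vector_mult_def sum_distrib_left)
  also have "\<dots> = (\<Sum>j\<in>UNIV. \<Sum>i\<in>UNIV. cnj (u $ i) * (A $ i $ j * w $ j))"
    by (rule sum.swap)
  also have "\<dots> = cdot (ctranspose A *v u) w"
    by (simp add: cdot_def matrix_vector_mult_def ctranspose_def sum_distrib_right
        mult.assoc mult.left_commute)
  finally show ?thesis .
qed

lemma cnj_cdot: "cnj (cdot u w) = cdot w u"
  by (simp add: cdot_def mult.commute)

lemma cdot_self: "cdot u u = complex_of_real (\<Sum>i\<in>UNIV. (cmod (u $ i))\<^sup>2)"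
  unfolding cdot_def of_real_sum
  by (intro sum.cong refl) (metis complex_norm_square mult.commute)

lemma ctranspose_ctranspose [simp]: "ctranspose (ctranspose A) = A"
  by (simp add: ctranspose_def vec_eq_iff)

lemma ctranspose_mult: "ctranspose (A ** B) = ctranspose B ** ctranspose A"
  by (simp add: ctranspose_def matrix_matrix_mult_def vec_eq_iff mult.commute)

lemma ctranspose_add: "ctranspose (A + B) = ctranspose A + ctranspose B"
  by (simp add: ctranspose_def vec_eq_iff)

lemma ctranspose_scaleR: "ctranspose (c *\<^sub>R A) = c *\<^sub>R ctranspose A"
  by (simp add: ctranspose_def vec_eq_iff)

lemma ctranspose_sum: "ctranspose (\<Sum>i\<in>S. f i) = (\<Sum>i\<in>S. ctranspose (f i))"
  by (simp add: ctranspose_def vec_eq_iff)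

lemma ctranspose_mat1 [simp]: "ctranspose (mat 1) = mat 1"
  by (simp add: ctranspose_def mat_def vec_eq_iff)

lemma ctranspose_outer: "ctranspose (outer u w) = outer w u"
  by (simp add: ctranspose_def outer_def vec_eq_iff mult.commute)

lemma outer_mult: "outer x y *v w = cdot y w *s x"
  by (simp add: outer_def cdot_def matrix_vector_mult_def vec_eq_iff sum_distrib_left
      sum_distrib_right mult_ac)

lemma cdot_scale: "cdot u (c *s w) = c * cdot u w"
  by (simp add: cdot_def sum_distrib_left mult_ac)

lemma cdot_add: "cdot u (w + z) = cdot u w + cdot u z"
  by (simp add: cdot_def sum.distrib algebra_simps)

lemma ctranspose_interference:
  "ctranspose (interference L a v vr l x) = interference L a v vr l x"
  by (simp add: interference_def ctranspose_add ctranspose_sum ctranspose_scaleR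
      ctranspose_mult ctranspose_outer matrix_mul_assoc)

lemma cdot_lin:
  "cdot w ((\<Sum>i\<in>S. f i) *v w) = (\<Sum>i\<in>S. cdot w (f i *v w))" if "finite S"
  using that
  by (induction S rule: finite_induct)
    (simp_all add: matrix_vector_mult_add_rdistrib cdot_add, simp add: cdot_def)

lemma cdot_scaleR: "cdot w ((c *\<^sub>R A) *v w) = of_real c * cdot w (A *v w)"
  unfolding cdot_def matrix_vector_mult_def
  by (simp add: sum_distrib_left) (simp add: scaleR_conv_of_real mult_ac)

lemma invertible_interference:
  assumes "\<forall>i\<in>{1..L}. 0 \<le> v i" and "0 < vr"
  shows "invertible (interference L a v vr l x)"
proof -
  let ?C = "interference L a v vr l x"
  have "w = 0" if C: "?C *v w = 0" for w
  proof -
    define g where "g i = cdot w (angle_matrix (a i) *v x)" for i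
    have "cdot w ((angle_matrix (a i) ** outer x x ** ctranspose (angle_matrix (a i))) *v w)
        = of_real ((cmod (g i))\<^sup>2)" for i
    proof -
      have "cdot x (ctranspose (angle_matrix (a i)) *v w) = cnj (g i)"
        unfolding g_def cdot_mult_right[of w] by (simp only: cnj_cdot)
      moreover have "cdot w (angle_matrix (a i) *v x) = g i"
        by (simp add: g_def)
      ultimately have "cdot w ((angle_matrix (a i) ** outer x x ** ctranspose (angle_matrix (a i))) *v w)
          = g i * cnj (g i)"
        by (simp del: matrix_vector_mul_assoc add: matrix_vector_mul_assoc[symmetric] outer_mult cdot_scale
            vector_scalar_commute mult.commute)
      then show ?thesis
        by (simp only: complex_norm_square)
    qed
    then have q: "cdot w (?C *v w) = of_real ((\<Sum>i\<in>{1..L} - {l}. v i * (cmod (g i))\<^sup>2)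
        + vr * (\<Sum>i\<in>UNIV. (cmod (w $ i))\<^sup>2))"
      by (simp add: interference_def matrix_vector_mult_add_rdistrib cdot_add cdot_lin
          cdot_scaleR cdot_self)
    have "cdot w (?C *v w) = 0"
      using C by (simp add: cdot_def)
    then have "(\<Sum>i\<in>{1..L} - {l}. v i * (cmod (g i))\<^sup>2)
        + vr * (\<Sum>i\<in>UNIV. (cmod (w $ i))\<^sup>2) = 0"
      unfolding q of_real_eq_0_iff .
    moreover have "0 \<le> (\<Sum>i\<in>{1..L} - {l}. v i * (cmod (g i))\<^sup>2)"
      using assms(1) by (intro sum_nonneg) auto
    moreover have "0 \<le> (\<Sum>i\<in>UNIV. (cmod (w $ i))\<^sup>2)"
      by (intro sum_nonneg) auto
    ultimately have "(\<Sum>i\<in>UNIV. (cmod (w $ i))\<^sup>2) = 0"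
      using assms(2) by (simp add: add_nonneg_eq_0_iff)
    then show "w = 0"
      by (simp add: sum_nonneg_eq_0_iff vec_eq_iff)
  qed
  then obtain D where "D ** ?C = mat 1"
    using matrix_left_invertible_ker[of ?C] by auto
  then show ?thesis
    by (auto simp: invertible_left_inverse)
qed

lemma ctranspose_matrix_inv:
  assumes "invertible A" and "ctranspose A = A"
  shows "ctranspose (matrix_inv A) = matrix_inv A"
proof -
  have inv: "A ** matrix_inv A = mat 1" "matrix_inv A ** A = mat 1"
    using someI_ex[OF assms(1)[unfolded invertible_def]] by (simp_all add: matrix_inv_def)
  have "ctranspose (matrix_inv A) ** A = mat 1"
    using ctranspose_mult[of A "matrix_inv A"] by (simp add: assms(2) inv(1))
  then have "ctranspose (matrix_inv A) ** (A ** matrix_inv A) = matrix_inv A"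
    by (simp add: matrix_mul_assoc)
  then show ?thesis
    by (simp add: inv(1))
qed

lemma of_real_sinr:
  assumes "\<forall>i\<in>{1..L}. 0 \<le> v i" and "0 < vr"
  shows "complex_of_real (sinr L a v vr l x) = sinr_form L a v vr l x"
proof -
  let ?M = "ctranspose (angle_matrix (a l)) ** matrix_inv (interference L a v vr l x)
    ** angle_matrix (a l)"
  have "ctranspose ?M = ?M"
    by (simp add: ctranspose_mult matrix_mul_assoc
        ctranspose_matrix_inv invertible_interference assms ctranspose_interference)
  then have "cnj (cdot x (?M *v x)) = cdot x (?M *v x)"
    using cdot_mult_right[of x ?M x] cnj_cdot[of x "?M *v x"] by simp
  then have "cnj (sinr_form L a v vr l x) = sinr_form L a v vr l x"
    by (simp add: sinr_form_def)
  then show ?thesis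
    unfolding sinr_def by (simp add: complex_eq_iff)
qed

end

(* Put U = D \<otimes> I with D = diag(exp(j phi_t)). U is unitary and, by the mixed-product rule,
   commutes with every matrix I \<otimes> a a^H. Hence C(U x) = U C(x) U^H, so that
   C(U x)^(-1) = U C(x)^(-1) U^H, and all factors U cancel in the quadratic form. *)

theory Submission
  imports Defs
begin

text \<open>The mixed-product rule: an entry of the left side is a sum over index pairs
  \<open>p\<close>, and its summand splits into a factor in \<open>fst p\<close> and a factor in
  \<open>snd p\<close>.\<close>

lemma kron_mult: "(A \<otimes>\<^sub>K B) ** (C \<otimes>\<^sub>K D) = (A ** C) \<otimes>\<^sub>K (B ** D)"
proof -
  have "(\<Sum>p\<in>UNIV. A $ i $ fst p * B $ j $ snd p * (C $ fst p $ k * D $ snd p $ m))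
      = (\<Sum>p\<in>UNIV. A $ i $ p * C $ p $ k) * (\<Sum>q\<in>UNIV. B $ j $ q * D $ q $ m)" for i j k m
    unfolding sum_product sum.cartesian_product UNIV_Times_UNIV
    by (intro sum.cong) (auto simp: mult_ac)
  then show ?thesis
    by (simp add: kron_def matrix_matrix_mult_def vec_eq_iff)
qed

lemma kron_mat1: "mat 1 \<otimes>\<^sub>K mat 1 = mat 1"
  by (auto simp: kron_def mat_def vec_eq_iff prod_eq_iff)

lemma ctranspose_kron: "ctranspose (A \<otimes>\<^sub>K B) = ctranspose A \<otimes>\<^sub>K ctranspose B"
  by (simp add: kron_def ctranspose_def vec_eq_iff)

lemma diag_matrix_mult: "diag_matrix c ** diag_matrix d = diag_matrix (\<lambda>i. c i * d i)"
  by (simp add: diag_matrix_def matrix_matrix_mult_def vec_eq_iff mult_delta_left)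

lemma ctranspose_diag_matrix: "ctranspose (diag_matrix d) = diag_matrix (\<lambda>i. cnj (d i))"
  by (auto simp: ctranspose_def diag_matrix_def vec_eq_iff)

lemma diag_matrix_1: "diag_matrix (\<lambda>_. 1) = mat 1"
  by (simp add: diag_matrix_def mat_def)

lemma diag_matrix_unitary:
  assumes "\<And>i. cmod (d i) = 1"
  shows "diag_matrix d ** ctranspose (diag_matrix d) = mat 1"
proof -
  have "d i * cnj (d i) = 1" for i
    using complex_norm_square[of "d i"] assms by simp
  then show ?thesis
    by (simp add: ctranspose_diag_matrix diag_matrix_mult diag_matrix_1)
qed

lemma ctranspose_angle_matrix: "ctranspose (angle_matrix a) = angle_matrix a"
  by (simp add: angle_matrix_def ctranspose_kron ctranspose_outer)

text \<open>The two matrices carry their identity factor in opposite slots, so by the mixed-product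
  rule both products equal \<open>D \<otimes>\<^sub>K outer a a\<close>.\<close>

lemma kron_mat1_commute_angle_matrix:
  "(D \<otimes>\<^sub>K mat 1) ** angle_matrix a = angle_matrix a ** (D \<otimes>\<^sub>K mat 1)"
  by (simp add: angle_matrix_def kron_mult)

lemma outer_matrix_vector_mult:
  "outer (A *v x) (B *v y) = A ** outer x y ** ctranspose B"
proof -
  have "(\<Sum>m\<in>UNIV. A $ i $ m * x $ m) * cnj (\<Sum>k\<in>UNIV. B $ j $ k * y $ k)
      = (\<Sum>k\<in>UNIV. (\<Sum>m\<in>UNIV. A $ i $ m * (x $ m * cnj (y $ k))) * cnj (B $ j $ k))" for i j
    by (simp add: sum_distrib_left sum_distrib_right mult_ac)
  then show ?thesis
    by (simp add: outer_def matrix_vector_mult_def matrix_matrix_mult_def ctranspose_def vec_eq_iff)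
qed

text \<open>\<open>matrix_inv\<close> is a Hilbert choice. For square matrices over a field a
  one-sided inverse is two-sided, so \<open>B\<close> is a witness for the choice and the only
  possible value.\<close>

lemma matrix_inv_unique_right:
  fixes A B :: "'a::field^'n^'n"
  assumes "A ** B = mat 1"
  shows "matrix_inv A = B"
proof -
  have BA: "B ** A = mat 1"
    using assms by (simp add: matrix_left_right_inverse)
  have "A ** matrix_inv A = mat 1 \<and> matrix_inv A ** A = mat 1"
    unfolding matrix_inv_def by (rule someI_ex) (use assms BA in blast)
  then have "B ** (A ** matrix_inv A) = B"
    by simp
  then show ?thesis
    by (simp add: matrix_mul_assoc BA)
qed

lemma matrix_inv_conjugate:
  fixes C U V :: "'a::field^'n^'n"
  assumes "invertible C" and "U ** V = mat 1"
  shows "matrix_inv (U ** C ** V) = U ** matrix_inv C ** V"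
proof (rule matrix_inv_unique_right)
  obtain D where D: "C ** D = mat 1"
    using assms(1) by (auto simp: invertible_def)
  have VU: "V ** U = mat 1"
    using assms(2) by (simp add: matrix_left_right_inverse)
  have "U ** C ** V ** (U ** matrix_inv C ** V) = U ** C ** (V ** U) ** matrix_inv C ** V"
    by (simp add: matrix_mul_assoc)
  \<comment> \<open>\<open>V ** U\<close> cancels in the middle, and uniqueness of the inverse
    replaces \<open>matrix_inv C\<close> by the witness \<open>D\<close>.\<close>
  also have "\<dots> = U ** (C ** D) ** V"
    by (simp add: VU matrix_mul_assoc matrix_inv_unique_right[OF D])
  finally show "U ** C ** V ** (U ** matrix_inv C ** V) = mat 1"
    by (simp add: D assms(2))
qed

lemma matrix_add_rdistrib: "(A + B) ** C = A ** C + B ** C"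
  by (simp add: matrix_matrix_mult_def vec_eq_iff distrib_right sum.distrib)

text \<open>Linearity of \<open>M \<mapsto> U ** M ** V\<close>, with real coefficients to match the
  weighted sum in \<open>interference\<close>.\<close>

lemma matrix_conjugate_sum:
  fixes U V :: "complex^'n^'n"
  assumes "finite S"
  shows "U ** (\<Sum>i\<in>S. c i *\<^sub>R f i) ** V = (\<Sum>i\<in>S. c i *\<^sub>R (U ** f i ** V))"
proof -
  have conj: "U ** (k *\<^sub>R M) ** V = k *\<^sub>R (U ** M ** V)" for k :: real and M
    by (simp only: matrix_scalar_ac flip: scalar_matrix_assoc)
  \<comment> \<open>Base case of the induction, read off from homogeneity with the scalar 0.\<close>
  have zero: "U ** (0 :: complex^'n^'n) ** V = 0"
    using conj[of 0 0] by (simp only: scaleR_zero_left)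
  show ?thesis
    using assms
    by (induction S rule: finite_induct)
      (simp_all add: matrix_add_ldistrib matrix_add_rdistrib conj zero)
qed

text \<open>In each clutter term the outer factors \<open>U\<close> and \<open>ctranspose U\<close>
  of the transformed \<open>outer x x\<close> move outwards past the angle matrices; the noise term
  is fixed because \<open>U\<close> is unitary.\<close>

lemma interference_unitary:
  fixes U :: "complex^('t::finite \<times> 'n::finite)^('t \<times> 'n)"
  assumes unitary: "U ** ctranspose U = mat 1"
    and commute: "\<And>i. U ** angle_matrix (a i) = angle_matrix (a i) ** U"
  shows "interference L a v vr l (U *v x) = U ** interference L a v vr l x ** ctranspose U"
proof -
  \<comment> \<open>Conjugate transpose of the commutation hypothesis; the angle matrix is
    Hermitian.\<close>
  have commute': "ctranspose U ** angle_matrix (a i) = angle_matrix (a i) ** ctranspose U" for i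
    using arg_cong[OF commute, of ctranspose i]
    by (simp add: ctranspose_mult ctranspose_angle_matrix)
  have "angle_matrix (a i) ** outer (U *v x) (U *v x) ** angle_matrix (a i)
      = U ** (angle_matrix (a i) ** outer x x ** angle_matrix (a i)) ** ctranspose U" for i
  proof -
    let ?B = "angle_matrix (a i) :: complex^('t \<times> 'n)^('t \<times> 'n)"
    have "?B ** outer (U *v x) (U *v x) ** ?B
        = (?B ** U) ** outer x x ** (ctranspose U ** ?B)"
      by (simp only: outer_matrix_vector_mult matrix_mul_assoc)
    also have "\<dots> = (U ** ?B) ** outer x x ** (?B ** ctranspose U)"
      by (simp only: commute commute')
    finally show ?thesis
      by (simp only: matrix_mul_assoc)
  qed
  moreover have "U ** (vr *\<^sub>R mat 1) ** ctranspose U = vr *\<^sub>R mat 1"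
    \<comment> \<open>A sum over the one-point set \<open>{()}\<close> gives the rule for a single
      scaled matrix.\<close>
    using matrix_conjugate_sum[of "{()}" U "\<lambda>_. vr" "\<lambda>_. mat 1"] by (simp add: unitary)
  ultimately show ?thesis
    by (simp add: interference_def ctranspose_angle_matrix matrix_add_ldistrib
        matrix_add_rdistrib matrix_conjugate_sum)
qed

lemma sinr_unitary:
  fixes U :: "complex^('t::finite \<times> 'n::finite)^('t \<times> 'n)"
  assumes "\<forall>i\<in>{1..L}. 0 \<le> v i" and "0 < vr"
    and unitary: "U ** ctranspose U = mat 1"
    and commute: "\<And>i. U ** angle_matrix (a i) = angle_matrix (a i) ** U"
  shows "sinr L a v vr l (U *v x) = sinr L a v vr l x"
proof -
  let ?B = "angle_matrix (a l) :: complex^('t \<times> 'n)^('t \<times> 'n)"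
  let ?R = "matrix_inv (interference L a v vr l x)"
  have unitary': "ctranspose U ** U = mat 1"
    using unitary by (simp add: matrix_left_right_inverse)
  \<comment> \<open>The trailing \<open>U\<close> is the one applied to \<open>x\<close>. It cancels
    against \<open>ctranspose U\<close> from the conjugated inverse, which leaves one
    \<open>U\<close> in front.\<close>
  have "?B ** matrix_inv (interference L a v vr l (U *v x)) ** ?B ** U
      = ?B ** (U ** ?R ** ctranspose U) ** (?B ** U)"
    by (simp add: interference_unitary unitary commute matrix_inv_conjugate
        invertible_interference assms(1,2) matrix_mul_assoc)
  also have "\<dots> = (?B ** U) ** ?R ** ctranspose U ** (?B ** U)"
    by (simp only: matrix_mul_assoc)
  also have "\<dots> = (U ** ?B) ** ?R ** ctranspose U ** (U ** ?B)"
    by (simp only: commute)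
  also have "\<dots> = (U ** ?B) ** ?R ** (ctranspose U ** U) ** ?B"
    by (simp only: matrix_mul_assoc)
  also have "\<dots> = U ** (?B ** ?R ** ?B)"
    by (simp add: unitary' matrix_mul_assoc)
  finally have "(?B ** matrix_inv (interference L a v vr l (U *v x)) ** ?B) *v (U *v x)
      = U *v ((?B ** ?R ** ?B) *v x)"
    by (simp add: matrix_vector_mul_assoc)
  \<comment> \<open>A unitary matrix preserves the inner product; this removes that leading
    \<open>U\<close> together with the one in the left argument.\<close>
  moreover have "cdot (U *v x) (U *v y) = cdot x y" for y
    by (simp add: cdot_mult_right matrix_vector_mul_assoc unitary')
  ultimately show ?thesis
    by (simp only: sinr_def sinr_form_def ctranspose_angle_matrix)
qed

theorem mainTheorem2:
  fixes K L :: nat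
    and a :: "nat \<Rightarrow> complex^'n"
    and \<sigma>2 :: "nat \<Rightarrow> real" and \<sigma>r2 :: real
    and l :: "nat \<Rightarrow> nat" and k :: nat
    and x :: "complex^('t::finite \<times> 'n)" and \<phi> :: "'t \<Rightarrow> real"
  assumes "K \<ge> 1" and "L \<ge> 1"
    and "\<forall>i\<in>{1..L}. \<sigma>2 i \<ge> 0"
    and "\<sigma>r2 > 0"
    and "\<forall>k'\<in>{1..K}. l k' \<in> {1..L}"
    and "k \<in> {1..K}"
  shows "sinr L a \<sigma>2 \<sigma>r2 (l k)
           ((diag_matrix (\<lambda>t. exp (\<i> * complex_of_real (\<phi> t))) \<otimes>\<^sub>K (mat 1 :: complex^'n^'n)) *v x)
         = sinr L a \<sigma>2 \<sigma>r2 (l k) x"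
  \<comment> \<open>What remains is unitarity, where the phases \<phi> enter only through the
    modulus 1 of the diagonal entries, and commutation with the angle matrices.\<close>
  by (rule sinr_unitary[OF assms(3,4)])
    (simp_all add: ctranspose_kron kron_mult diag_matrix_unitary kron_mat1
      kron_mat1_commute_angle_matrix)

end
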